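(* Let $A\in\mathbb{R}^{m\times n}$ and $b\in\mathbb{R}^m$ with $m>n$, and assume the genericity condition $\sigma'_n>\sigma_{n+1}$, where $\sigma'_n$ is the smallest singular value of $A$ and $\sigma_{n+1}$ is the smallest singular value of $[A,b]\in\mathbb{R}^{m\times(n+1)}$. Let $L\in\mathbb{R}^{n\times k}$ with $k\le n$. Let $\lambda_{n+1}=\sigma_{n+1}^2$, $B_\lambda=A^TA-\lambda_{n+1}I_n$, and let $x=B_\lambda^{-1}A^Tb$ be the total least squares solution. Then the condition number $K(L,A,b)$ of $L^Tx$ (the operator norm of the Fréchet derivative of $(A,b)\mapsto L^Tx$, as defined in the context) is $$K(L,A,b)=\|C\|_2^{1/2},$$ where $C$ is the $k\times k$ symmetric matrix $$C=(1+\|x\|_2^2)\,L^TB_\lambda^{-1}\left(A^TA+\lambda_{n+1}\left(I_n-\frac{2xx^T}{1+\|x\|_2^2}\right)\right)B_\lambda^{-1}L .$$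
   Context: Singular values are in nonincreasing order: $\sigma_1\ge\dots\ge\sigma_{n+1}$ are those of $[A,b]$ and $\sigma'_1\ge\dots\ge\sigma'_n$ are those of $A$. The total least squares (TLS) problem is $\min_{E,\epsilon}\|(E,\epsilon)\|_F$ subject to $(A+E)x=b+\epsilon$; under the genericity condition $\sigma'_n>\sigma_{n+1}$ its solution $x$ exists, is unique, and equals $x=(A^TA-\lambda_{n+1}I_n)^{-1}A^Tb$, where $\lambda_{n+1}=\sigma_{n+1}^2$. The mapping $g$ is $g(A,b)=L^Tx=L^T(A^TA-\lambda_{n+1}I_n)^{-1}A^Tb\in\mathbb{R}^k$, where $\lambda_{n+1}=\lambda_{n+1}(A,b)$ is regarded as a function of $(A,b)$ (the smallest eigenvalue of $[A,b]^T[A,b]$); $L$ is fixed. The genericity condition is open, so $g$ is defined in a neighborhood of $(A,b)$ in $\mathbb{R}^{m\times n}\times\mathbb{R}^m$, and it is Fréchet differentiable there. Data are measured with the norm $\|(\Delta A,\Delta b)\|_F=\sqrt{\|\Delta A\|_F^2+\|\Delta b\|_2^2}$, and the (absolute) condition number is $$K(L,A,b)=\max_{(\Delta A,\Delta b)\neq 0}\frac{\|g'(A,b).(\Delta A,\Delta b)\|_2}{\|(\Delta A,\Delta b)\|_F}.$$ For matrices, $\|\cdot\|_2$ is the spectral norm. *)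

theory Defs
  imports "HOL-Analysis.Analysis"
begin

definition eigenvalues :: "real^'n^'n \<Rightarrow> real set" where
  "eigenvalues M = {l. \<exists>v. v \<noteq> 0 \<and> M *v v = l *\<^sub>R v}"

text \<open>
  Intended for matrices with at least as many rows as columns: then the singular values are
  the square roots of the eigenvalues of \<open>transpose M ** M\<close>. This is a nonempty finite set of
  nonnegative numbers, so \<open>Min\<close> is meaningful; multiplicities do not affect the minimum.
\<close>

definition singular_values :: "real^'n^'m \<Rightarrow> real set" where
  "singular_values M = sqrt ` eigenvalues (transpose M ** M)"

definition min_singular_value :: "real^'n^'m \<Rightarrow> real" where
  "min_singular_value M = Min (singular_values M)"

text \<open>The matrix \<open>[A, b]\<close>; the extra column is indexed by \<open>None\<close>.\<close>

definition append_column :: "real^'n^'m \<Rightarrow> real^'m \<Rightarrow> real^('n option)^'m" where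
  "append_column A b = (\<chi> i j. case j of None \<Rightarrow> b $ i | Some l \<Rightarrow> A $ i $ l)"

definition tls_lambda :: "real^'n^'m \<Rightarrow> real^'m \<Rightarrow> real" where
  "tls_lambda A b = (min_singular_value (append_column A b))\<^sup>2"

definition tls_generic :: "real^'n^'m \<Rightarrow> real^'m \<Rightarrow> bool" where
  "tls_generic A b \<longleftrightarrow> min_singular_value A > min_singular_value (append_column A b)"

text \<open>
  The norm on \<open>real^'n^'m\<close> is the Frobenius norm, and the norm of a pair \<open>(E, e)\<close> is the square
  root of \<open>(norm E)\<^sup>2 + (norm e)\<^sup>2\<close>.
\<close>

definition is_tls_solution :: "real^'n^'m \<Rightarrow> real^'m \<Rightarrow> real^'n \<Rightarrow> bool" where
  "is_tls_solution A b x \<longleftrightarrow>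
     (\<exists>E e. (A + E) *v x = b + e \<and>
        (\<forall>E' e' x'. (A + E') *v x' = b + e' \<longrightarrow> norm (E, e) \<le> norm (E', e')))"

definition tls_B :: "real^'n^'m \<Rightarrow> real^'m \<Rightarrow> real^'n^'n" where
  "tls_B A b = transpose A ** A - tls_lambda A b *\<^sub>R mat 1"

text \<open>The closed form of the solution, valid in the generic case (where \<open>tls_B A b\<close> is invertible).\<close>

definition tls_x :: "real^'n^'m \<Rightarrow> real^'m \<Rightarrow> real^'n" where
  "tls_x A b = matrix_inv (tls_B A b) *v (transpose A *v b)"

text \<open>
  Defined for all \<open>(A, b)\<close>, but with unspecified values where \<open>tls_B A b\<close> is singular; only its
  germ at a generic point is used.
\<close>

definition tls_map :: "real^'k^'n \<Rightarrow> (real^'n^'m) \<times> (real^'m) \<Rightarrow> real^'k" where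
  "tls_map L = (\<lambda>(A, b). transpose L *v tls_x A b)"

text \<open>
  \<open>onorm\<close> is the supremum of \<open>norm (f h) / norm h\<close>, where \<open>h = 0\<close> contributes \<open>0\<close>. The domain is
  finite-dimensional, so the supremum is a maximum.
\<close>

definition tls_cond :: "real^'k^'n \<Rightarrow> real^'n^'m \<Rightarrow> real^'m \<Rightarrow> real" where
  "tls_cond L A b = onorm (frechet_derivative (tls_map L) (at (A, b)))"

definition spectral_norm :: "real^'n^'m \<Rightarrow> real" where
  "spectral_norm M = onorm ((*v) M)"

definition outer :: "real^'n \<Rightarrow> real^'n \<Rightarrow> real^'n^'n" where
  "outer x y = (\<chi> i j. x $ i * y $ j)"

end

theory Submission
  imports Defs
begin

text \<open>
  Write \<open>r = A x - b\<close> and \<open>N = 1 + |x|\<^sup>2\<close>. Genericity makes \<open>B\<close> positive definite and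
  \<open>(x, -1)\<close> an eigenvector of \<open>[A, b]\<^sup>T [A, b]\<close> for \<open>\<lambda>\<close>, that is, \<open>A\<^sup>T r = \<lambda> x\<close> and
  \<open>b\<^sup>T r = -\<lambda>\<close>. Hence \<open>|A y - b|\<^sup>2 = \<lambda> (1 + |y|\<^sup>2) + (y - x)\<^sup>T B (y - x)\<close>, and as the
  smallest correction admitting \<open>y\<close> has squared norm \<open>|A y - b|\<^sup>2 / (1 + |y|\<^sup>2)\<close>, \<open>x\<close> is the unique
  solution.

  For a second generic pair \<open>(A', b')\<close> the differences \<open>\<lambda>' - \<lambda>\<close> and \<open>B (x' - x)\<close> are exact
  sums of products of a linear expression in \<open>(A' - A, b' - b)\<close> (or of \<open>\<lambda>' - \<lambda>\<close>) and a factor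
  depending on \<open>x'\<close>. Continuity of \<open>x'\<close> therefore already gives differentiability, with
  \<open>B Dx(E, e) = (2 s\<^sup>T r / N) x - E\<^sup>T r - A\<^sup>T s\<close> where \<open>s = E x - e\<close>. Composing this linear map
  with its adjoint yields \<open>N (A\<^sup>T A + \<lambda> (I - 2 x x\<^sup>T / N))\<close>, so that \<open>C = J J\<^sup>T\<close> for the derivative
  \<open>J\<close>, and \<open>|J J\<^sup>T| = |J|\<^sup>2\<close>.
\<close>

section \<open>Smallest singular value\<close>

lemma norm_matrix_vector_mult_le:
  fixes M :: "real^'n^'m"
  shows "norm (M *v w) \<le> norm M * norm w"
proof -
  have "norm (M *v w) \<le> L2_set (\<lambda>i. norm (M $ i) * norm w) UNIV"
    unfolding norm_vec_def[of "M *v w"]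
    by (rule L2_set_mono) (simp_all add: matrix_mult_dot Cauchy_Schwarz_ineq2)
  then show ?thesis
    by (simp add: L2_set_left_distrib norm_vec_def[of M])
qed

lemma norm_vector_matrix_mult_le:
  fixes M :: "real^'n^'m"
  shows "norm (w v* M) \<le> norm w * norm M"
proof (cases "w v* M = 0")
  case False
  have "norm (w v* M) * norm (w v* M) = w \<bullet> (M *v (w v* M))"
    by (simp add: dot_lmul_matrix[symmetric] power2_norm_eq_inner[symmetric] power2_eq_square)
  also have "\<dots> \<le> norm w * (norm M * norm (w v* M))"
    by (meson Cauchy_Schwarz_ineq2 abs_le_D1 mult_left_mono norm_ge_zero norm_matrix_vector_mult_le order_trans)
  finally show ?thesis using False by (simp add: mult.assoc[symmetric])
qed simp

text \<open>The Frobenius norm is compatible with both products with constant 1. The two instances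
  supply bilinearity and continuity in matrix and vector jointly, and the derivative rule
  \<open>has_derivative_vanishing\<close> below.\<close>

interpretation mv: bounded_bilinear "(*v) :: real^'n^'m \<Rightarrow> real^'n \<Rightarrow> real^'m"
proof
  show "\<exists>K. \<forall>(M::real^'n^'m) w. norm (M *v w) \<le> norm M * norm w * K"
    by (rule exI[of _ 1]) (simp add: norm_matrix_vector_mult_le)
qed (simp_all add: matrix_vector_mult_add_rdistrib matrix_vector_right_distrib
    scaleR_matrix_vector_assoc matrix_vector_mult_scaleR)

interpretation vm: bounded_bilinear "(v*) :: real^'m \<Rightarrow> real^'n^'m \<Rightarrow> real^'n"
proof
  show "\<exists>K. \<forall>w (M::real^'n^'m). norm (w v* M) \<le> norm w * norm M * K"
    by (rule exI[of _ 1]) (simp add: norm_vector_matrix_mult_le)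
qed (simp_all add: vec_eq_iff vector_matrix_mult_def sum.distrib sum_distrib_left algebra_simps)

text \<open>With \<open>u = S *v v\<close>, the form at \<open>v - t u\<close> is
  \<open>-2 t |u|^2 + t^2 (u . S u)\<close>. For small t > 0 the linear term dominates, so
  nonnegativity forces u = 0.\<close>

lemma positive_semidefinite_ker:
  fixes S :: "real^'n^'n"
  assumes "transpose S = S" "\<And>w. 0 \<le> w \<bullet> (S *v w)" "v \<bullet> (S *v v) = 0"
  shows "S *v v = 0"
proof (rule ccontr)
  assume nz: "S *v v \<noteq> 0"
  define u where "u = S *v v"
  have pos: "0 < u \<bullet> u" using nz by (simp add: u_def)
  have sym: "u \<bullet> (S *v v) = v \<bullet> (S *v u)"
    by (metis assms(1) dot_lmul_matrix inner_commute transpose_matrix_vector)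
  have q: "0 \<le> - 2 * t * (u \<bullet> u) + t\<^sup>2 * (u \<bullet> (S *v u))" for t
  proof -
    have "0 \<le> (v - t *\<^sub>R u) \<bullet> (S *v (v - t *\<^sub>R u))" by (rule assms(2))
    also have "\<dots> = - 2 * t * (u \<bullet> u) + t\<^sup>2 * (u \<bullet> (S *v u))"
      using sym assms(3)
      by (simp add: mv.diff_right mv.scaleR_right inner_diff inner_commute u_def[symmetric]
          algebra_simps power2_eq_square)
    finally show ?thesis .
  qed
  define k where "k = u \<bullet> (S *v u)"
  have "0 \<le> k" using assms(2) k_def by blast
  have "2 * (u \<bullet> u) \<le> t * k" if "t > 0" for t
    using q[of t] that by (simp add: k_def power2_eq_square mult.assoc)
  \<comment> \<open>The \<open>+ 1\<close> keeps t positive and finite when k = 0; the factor k / (k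
    + 1) < 1 then contradicts the factor 2.\<close>
  from this[of "(u \<bullet> u) / (k + 1)"] pos \<open>0 \<le> k\<close> have "2 * (u \<bullet> u) \<le> (u \<bullet> u) * (k / (k + 1))"
    by simp
  also have "\<dots> \<le> (u \<bullet> u) * 1"
    using pos \<open>0 \<le> k\<close> by (intro mult_left_mono) auto
  finally show False using pos by simp
qed

text \<open>Eigenvectors of distinct eigenvalues are orthogonal, so one eigenvector per eigenvalue
  gives an independent family. Finiteness is what makes \<open>Min\<close> in
  \<open>min_singular_value\<close> meaningful.\<close>

lemma finite_eigenvalues_symmetric:
  fixes S :: "real^'n^'n"
  assumes "transpose S = S"
  shows "finite (eigenvalues S)"
proof -
  obtain f where f: "\<And>l. l \<in> eigenvalues S \<Longrightarrow> f l \<noteq> 0 \<and> S *v f l = l *\<^sub>R f l"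
    using bchoice[of "eigenvalues S" "\<lambda>l v. v \<noteq> 0 \<and> S *v v = l *\<^sub>R v"]
    by (auto simp: eigenvalues_def)
  have orth: "f l \<bullet> f k = 0" if "l \<in> eigenvalues S" "k \<in> eigenvalues S" "l \<noteq> k" for l k
  proof -
    have "l * (f l \<bullet> f k) = (S *v f l) \<bullet> f k" using f[OF that(1)] by simp
    also have "\<dots> = f l \<bullet> (S *v f k)"
      by (metis assms dot_lmul_matrix transpose_matrix_vector)
    also have "\<dots> = k * (f l \<bullet> f k)" using f[OF that(2)] by simp
    finally show ?thesis using that(3) by simp
  qed
  have inj: "inj_on f (eigenvalues S)"
    by (rule inj_onI) (metis f inner_eq_zero_iff orth)
  have "independent (f ` eigenvalues S)"
  proof (rule pairwise_orthogonal_independent)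
    show "pairwise orthogonal (f ` eigenvalues S)"
      by (auto simp: pairwise_def orthogonal_def intro!: orth)
    show "0 \<notin> f ` eigenvalues S" using f by force
  qed
  then show ?thesis
    using independent_bound inj finite_imageD by blast
qed

text \<open>Turns the definition through eigenvalues into a variational one: the value is the
  minimum s of |M w| on the unit sphere, attained by compactness. Everything later uses only these
  two facts.\<close>

lemma min_singular_value_characterization:
  fixes M :: "real^'n^'m"
  shows "\<exists>v. norm v = 1 \<and> norm (M *v v) = min_singular_value M \<and>
             (M *v v) v* M = (min_singular_value M)\<^sup>2 *\<^sub>R v"
    and "min_singular_value M * norm w \<le> norm (M *v w)"
proof -
  define G where "G = transpose M ** M"
  have G: "G *v w = (M *v w) v* M" for w
    by (simp add: G_def matrix_vector_mul_assoc[symmetric])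
  have quad: "w \<bullet> (G *v w) = (norm (M *v w))\<^sup>2" for w
    by (simp add: G inner_commute[of w] dot_lmul_matrix power2_norm_eq_inner)
  have Gsym: "transpose G = G" by (simp add: G_def matrix_transpose_mul)
  obtain v where v: "norm v = 1" and vmin: "\<And>w. norm w = 1 \<Longrightarrow> norm (M *v v) \<le> norm (M *v w)"
  proof -
    have "\<exists>v\<in>sphere (0::real^'n) 1. \<forall>w\<in>sphere 0 1. norm (M *v v) \<le> norm (M *v w)"
    proof (rule continuous_attains_inf)
      show "sphere (0::real^'n) 1 \<noteq> {}" by simp
    qed (auto intro!: continuous_intros)
    then show ?thesis using that by auto
  qed
  define s where "s = norm (M *v v)"
  have lower: "s * norm w \<le> norm (M *v w)" for w
  proof (cases "w = 0")
    case False
    then have "s \<le> norm (M *v ((1 / norm w) *\<^sub>R w))"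
      unfolding s_def by (intro vmin) simp
    also have "\<dots> = norm (M *v w) / norm w" by (simp add: mv.scaleR_right)
    finally show ?thesis using False by (simp add: field_simps)
  qed simp
  have s0: "0 \<le> s" by (simp add: s_def)
  have eig: "G *v v = s\<^sup>2 *\<^sub>R v"
  proof -
    \<comment> \<open>S is positive semidefinite by \<open>lower\<close>, and its form vanishes at
      the minimiser v; hence v lies in its kernel, which is the eigenvalue equation.\<close>
    define S where "S = G - s\<^sup>2 *\<^sub>R mat 1"
    have S: "S *v w = G *v w - s\<^sup>2 *\<^sub>R w" for w
      by (simp add: S_def mv.diff_left mv.scaleR_left)
    have Sq: "w \<bullet> (S *v w) = (norm (M *v w))\<^sup>2 - (s * norm w)\<^sup>2" for w
      by (simp add: S inner_diff quad power_mult_distrib power2_norm_eq_inner)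
    have "S *v v = 0"
    proof (rule positive_semidefinite_ker)
      show "transpose S = S"
        using Gsym by (simp add: S_def vec_eq_iff transpose_def mat_def)
      show "0 \<le> w \<bullet> (S *v w)" for w
        using lower[of w] s0 by (simp add: Sq)
      show "v \<bullet> (S *v v) = 0" by (simp add: Sq s_def v)
    qed
    then show ?thesis by (simp add: S)
  qed
  have "min_singular_value M = s"
    unfolding min_singular_value_def singular_values_def G_def[symmetric]
  proof (rule Min_eqI)
    show "finite (sqrt ` eigenvalues G)" using finite_eigenvalues_symmetric[OF Gsym] by simp
    show "s \<in> sqrt ` eigenvalues G"
    proof
      show "s\<^sup>2 \<in> eigenvalues G" using v eig by (auto simp: eigenvalues_def intro!: exI[of _ v])
    qed (simp add: s0)
    show "s \<le> y" if y: "y \<in> sqrt ` eigenvalues G" for y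
    proof -
      obtain l w where w: "y = sqrt l" "w \<noteq> 0" "G *v w = l *\<^sub>R w"
        using y unfolding eigenvalues_def by blast
      have "(s * norm w)\<^sup>2 \<le> (norm (M *v w))\<^sup>2" using lower[of w] s0 by (intro power_mono) auto
      also have "\<dots> = l * (norm w)\<^sup>2" using quad[of w] w by (simp add: power2_norm_eq_inner)
      finally have "s\<^sup>2 \<le> l" using w by (simp add: power_mult_distrib)
      then show ?thesis unfolding w using real_le_rsqrt by blast
    qed
  qed
  then show "\<exists>v. norm v = 1 \<and> norm (M *v v) = min_singular_value M \<and>
             (M *v v) v* M = (min_singular_value M)\<^sup>2 *\<^sub>R v"
    and "min_singular_value M * norm w \<le> norm (M *v w)"
    using v eig lower by (auto simp: s_def G)
qed

lemma min_singular_value_nonneg: "0 \<le> min_singular_value (M :: real^'n^'m)"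
  using min_singular_value_characterization(1)[of M] by (metis norm_ge_zero)

text \<open>The unit minimiser for N serves as a test vector for M. By symmetry in M and N this
  gives a Lipschitz bound with constant 1.\<close>

lemma min_singular_value_le_add:
  fixes M N :: "real^'n^'m"
  shows "min_singular_value M \<le> min_singular_value N + norm (M - N)"
proof -
  obtain v where v: "norm v = 1" "norm (N *v v) = min_singular_value N"
    using min_singular_value_characterization(1) by blast
  have "min_singular_value M \<le> norm (M *v v)"
    using min_singular_value_characterization(2)[of M v] v by simp
  also have "\<dots> = norm (N *v v + (M - N) *v v)" by (simp add: mv.diff_left)
  also have "\<dots> \<le> norm (N *v v) + norm (M - N) * norm v"
    by (meson add_left_mono norm_matrix_vector_mult_le norm_triangle_ineq order_trans)
  finally show ?thesis using v by simp
qed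

lemma isCont_min_singular_value: "isCont (min_singular_value :: real^'n^'m \<Rightarrow> real) M"
proof -
  have "1-lipschitz_on UNIV (min_singular_value :: real^'n^'m \<Rightarrow> real)"
  proof (rule lipschitz_onI)
    show "dist (min_singular_value M) (min_singular_value N) \<le> 1 * dist M N" for M N :: "real^'n^'m"
      using min_singular_value_le_add[of M N] min_singular_value_le_add[of N M]
      by (simp add: dist_norm norm_minus_commute abs_le_iff)
  qed simp
  then show ?thesis
    using lipschitz_on_continuous_on continuous_on_eq_continuous_at open_UNIV by blast
qed

section \<open>Total least squares solution\<close>

text \<open>Block vectors (w, c) for the columns of [A, b]; the choice c = -1 turns the product with
  [A, b] into the residual A w - b.\<close>

definition extend_vec :: "real^'n \<Rightarrow> real \<Rightarrow> real^('n option)" where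
  "extend_vec w c = (\<chi> j. case j of None \<Rightarrow> c | Some l \<Rightarrow> w $ l)"

lemma sum_UNIV_option:
  fixes f :: "'n::finite option \<Rightarrow> 'a::comm_monoid_add"
  shows "sum f UNIV = f None + (\<Sum>l\<in>UNIV. f (Some l))"
  by (simp add: UNIV_option_conv sum.reindex)

lemma extend_vec_exhaust: obtains w c where "v = extend_vec w c"
proof
  show "v = extend_vec (\<chi> l. v $ Some l) (v $ None)"
    by (simp add: extend_vec_def vec_eq_iff split: option.split)
qed

lemma extend_vec_eq_iff: "extend_vec w c = extend_vec w' c' \<longleftrightarrow> w = w' \<and> c = c'"
  by (auto simp: extend_vec_def vec_eq_iff split: option.splits)

lemma scaleR_extend_vec: "t *\<^sub>R extend_vec w c = extend_vec (t *\<^sub>R w) (t * c)"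
  by (simp add: extend_vec_def vec_eq_iff split: option.split)

lemma norm_extend_vec: "(norm (extend_vec w c))\<^sup>2 = (norm w)\<^sup>2 + c\<^sup>2"
  by (simp only: power2_norm_eq_inner inner_vec_def sum_UNIV_option)
    (simp add: extend_vec_def power2_eq_square)

lemma append_column_mult: "append_column A b *v extend_vec w c = A *v w + c *\<^sub>R b"
  by (simp add: vec_eq_iff append_column_def extend_vec_def matrix_vector_mult_def sum_UNIV_option)

lemma mult_append_column: "u v* append_column A b = extend_vec (u v* A) (u \<bullet> b)"
  by (simp add: vec_eq_iff append_column_def extend_vec_def vector_matrix_mult_def inner_vec_def
      mult.commute split: option.split)

lemma linear_append_column: "linear (\<lambda>p. append_column (fst p) (snd p))"
  by (rule linearI) (auto simp: append_column_def vec_eq_iff split: option.split)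

section \<open>Definiteness of B and the equations satisfied by x\<close>

lemma tls_B_mult: "tls_B A b *v u = (A *v u) v* A - tls_lambda A b *\<^sub>R u"
  by (simp add: tls_B_def mv.diff_left mv.scaleR_left matrix_vector_mul_assoc[symmetric])

lemma tls_B_symmetric: "transpose (tls_B A b) = tls_B A b"
proof -
  have "transpose (transpose A ** A) = transpose A ** A" by (simp add: matrix_transpose_mul)
  then show ?thesis by (simp add: tls_B_def vec_eq_iff transpose_def mat_def)
qed

text \<open>The form of B is |A u|^2 - \<lambda> |u|^2, and the least singular value bounds |A u|
  below. In the generic case the factor on the left is positive, which makes B positive
  definite.\<close>

lemma tls_B_coercive:
  "((min_singular_value A)\<^sup>2 - tls_lambda A b) * (norm u)\<^sup>2 \<le> u \<bullet> (tls_B A b *v u)"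
proof -
  have "(min_singular_value A * norm u)\<^sup>2 \<le> (norm (A *v u))\<^sup>2"
    by (intro power_mono min_singular_value_characterization(2) mult_nonneg_nonneg
        min_singular_value_nonneg norm_ge_zero)
  moreover have "u \<bullet> ((A *v u) v* A) = (norm (A *v u))\<^sup>2"
    by (simp add: inner_commute[of u] dot_lmul_matrix power2_norm_eq_inner)
  ultimately show ?thesis
    by (simp add: tls_B_mult inner_diff power_mult_distrib algebra_simps
        power2_norm_eq_inner[symmetric])
qed

lemma tls_gap_pos:
  assumes "tls_generic A b"
  shows "0 < (min_singular_value A)\<^sup>2 - tls_lambda A b"
  using assms min_singular_value_nonneg power_strict_mono
  unfolding tls_generic_def tls_lambda_def by (metis diff_gt_0_iff_gt zero_less_numeral)

lemma invertible_tls_B: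
  assumes "tls_generic A b"
  shows "invertible (tls_B A b)"
proof -
  have "u = 0" if "tls_B A b *v u = 0" for u
    using tls_gap_pos[OF assms] tls_B_coercive[of A b u] that by (simp add: mult_le_0_iff)
  then show ?thesis
    by (simp add: invertible_left_inverse matrix_left_invertible_ker)
qed

lemma matrix_inv_mult_cancel:
  fixes M :: "real^'n^'n"
  assumes "invertible M"
  shows "matrix_inv M *v (M *v u) = u" "M *v (matrix_inv M *v u) = u"
proof -
  have "M ** matrix_inv M = mat 1 \<and> matrix_inv M ** M = mat 1"
    using assms unfolding invertible_def matrix_inv_def by (rule someI_ex)
  then show "matrix_inv M *v (M *v u) = u" "M *v (matrix_inv M *v u) = u"
    by (simp_all add: matrix_vector_mul_assoc)
qed

lemma tls_B_tls_x:
  assumes "tls_generic A b"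
  shows "tls_B A b *v tls_x A b = b v* A"
  using matrix_inv_mult_cancel(2)[OF invertible_tls_B[OF assms]] by (simp add: tls_x_def)

text \<open>
  The vector \<open>(x, -1)\<close> spans the eigenspace of \<open>[A, b]\<^sup>T [A, b]\<close> for the eigenvalue \<open>\<lambda>\<close>: by
  genericity no eigenvector has last entry \<open>0\<close>, and normalising this entry to \<open>-1\<close> turns the
  first block of the eigenvalue equation into the normal equation for \<open>x\<close>.
\<close>

lemma tls_residual:
  assumes "tls_generic A b"
  shows "(A *v tls_x A b - b) v* A = tls_lambda A b *\<^sub>R tls_x A b"
    and "(A *v tls_x A b - b) \<bullet> b = - tls_lambda A b"
proof -
  let ?M = "append_column A b" and ?l = "tls_lambda A b"
  show normal: "(A *v tls_x A b - b) v* A = ?l *\<^sub>R tls_x A b"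
    using tls_B_tls_x[OF assms] by (simp add: tls_B_mult vm.diff_left algebra_simps)
  obtain v where v: "norm v = 1" "(?M *v v) v* ?M = ?l *\<^sub>R v"
    using min_singular_value_characterization(1)[of ?M] by (auto simp: tls_lambda_def)
  obtain w c where w: "v = extend_vec w c" by (rule extend_vec_exhaust)
  have eig: "(A *v w + c *\<^sub>R b) v* A = ?l *\<^sub>R w" "(A *v w + c *\<^sub>R b) \<bullet> b = ?l * c"
    using v(2) by (auto simp: w append_column_mult mult_append_column scaleR_extend_vec extend_vec_eq_iff)
  have Bw: "tls_B A b *v w = - c *\<^sub>R (b v* A)"
    using eig(1) by (simp add: tls_B_mult vm.add_left vm.scaleR_left algebra_simps)
  have "tls_B A b *v (w + c *\<^sub>R tls_x A b) = 0"
    by (simp add: mv.add_right mv.scaleR_right Bw tls_B_tls_x[OF assms])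
  then have "w + c *\<^sub>R tls_x A b = 0"
    using matrix_inv_mult_cancel(1)[OF invertible_tls_B[OF assms]] by (metis mv.zero_right)
  then have wx: "w = - c *\<^sub>R tls_x A b" by (simp add: eq_neg_iff_add_eq_0)
  have eig': "- c * ((A *v tls_x A b - b) \<bullet> b) = c * ?l"
    using eig(2) unfolding wx by (simp add: mv.scaleR_right mv.minus_right inner_diff inner_add algebra_simps)
  have "c \<noteq> 0"
    using v(1) wx w norm_extend_vec[of w c] by auto
  moreover have "c * ((A *v tls_x A b - b) \<bullet> b + ?l) = 0"
    using eig' by (simp only: distrib_left mult_minus_left)
  ultimately show "(A *v tls_x A b - b) \<bullet> b = - ?l"
    by (simp add: eq_neg_iff_add_eq_0)
qed

lemma norm_tls_residual:
  assumes "tls_generic A b"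
  shows "(norm (A *v tls_x A b - b))\<^sup>2 = tls_lambda A b * (1 + (norm (tls_x A b))\<^sup>2)"
proof -
  let ?x = "tls_x A b"
  have "(norm (A *v ?x - b))\<^sup>2 = ((A *v ?x - b) v* A) \<bullet> ?x - (A *v ?x - b) \<bullet> b"
    by (simp only: dot_lmul_matrix power2_norm_eq_inner inner_diff_right)
  then show ?thesis
    by (simp only: tls_residual[OF assms] inner_scaleR_left power2_norm_eq_inner distrib_left)
qed

lemma tls_objective:
  assumes "tls_generic A b"
  shows "(norm (A *v y - b))\<^sup>2 = tls_lambda A b * (1 + (norm y)\<^sup>2)
           + (y - tls_x A b) \<bullet> (tls_B A b *v (y - tls_x A b))"
proof -
  define x where "x = tls_x A b"
  define d where "d = y - x"
  define r where "r = A *v x - b"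
  define l where "l = tls_lambda A b"
  have y: "y = x + d" by (simp add: d_def)
  have "A *v y - b = r + A *v d" by (simp add: y r_def mv.add_right)
  then have "(norm (A *v y - b))\<^sup>2 = (norm r)\<^sup>2 + 2 * (r \<bullet> (A *v d)) + (norm (A *v d))\<^sup>2"
    by (simp add: power2_norm_eq_inner inner_add inner_commute)
  \<comment> \<open>The cross term is converted by the normal equation \<open>A^T r = l x\<close>.
    Together with the l-terms of |r|^2 and |A d|^2 it completes the square to l (1 + |x +
    d|^2).\<close>
  also have "r \<bullet> (A *v d) = l * (x \<bullet> d)"
    using tls_residual(1)[OF assms] by (simp add: dot_lmul_matrix[symmetric] r_def x_def l_def)
  also have "(norm r)\<^sup>2 = l * (1 + (norm x)\<^sup>2)"
    using norm_tls_residual[OF assms] by (simp add: r_def x_def l_def)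
  also have "(norm (A *v d))\<^sup>2 = d \<bullet> (tls_B A b *v d) + l * (norm d)\<^sup>2"
    by (simp add: tls_B_mult inner_diff inner_commute[of d "_ v* _"] dot_lmul_matrix
        power2_norm_eq_inner l_def[symmetric])
  finally show ?thesis
    by (simp add: l_def[symmetric] x_def[symmetric] d_def[symmetric])
      (simp add: y power2_norm_eq_inner inner_add inner_commute algebra_simps)
qed

text \<open>The rectangular matrix u w^T; \<open>outer\<close> has only square values.\<close>

definition outer_product :: "real^'m \<Rightarrow> real^'n \<Rightarrow> real^'n^'m" where
  "outer_product u w = (\<chi> i j. u $ i * w $ j)"

lemma outer_product_mult: "outer_product u w *v z = (w \<bullet> z) *\<^sub>R u"
  by (simp add: outer_product_def vec_eq_iff matrix_vector_mult_def inner_vec_def sum_distrib_left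
      algebra_simps)

lemma mult_outer_product: "z v* outer_product u w = (u \<bullet> z) *\<^sub>R w"
  by (simp add: outer_product_def vec_eq_iff vector_matrix_mult_def inner_vec_def
      sum_distrib_left algebra_simps)

text \<open>In the Frobenius inner product u w^T represents the functional E \<mapsto> u . (E w).
  This is how adjoints in the matrix argument are read off below.\<close>

lemma inner_outer_product: "E \<bullet> outer_product u w = (E *v w) \<bullet> u"
  by (simp add: outer_product_def inner_vec_def matrix_vector_mult_def sum_distrib_left
      algebra_simps)

lemma norm_outer_product: "(norm (outer_product u w))\<^sup>2 = (norm u)\<^sup>2 * (norm w)\<^sup>2"
  by (simp add: power2_norm_eq_inner inner_outer_product outer_product_mult)

text \<open>Feasibility says that [E, e] maps (y, -1) to -(A y - b), so the Frobenius norm of [E, e]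
  cannot be too small.\<close>

lemma tls_correction_lower_bound:
  fixes A E :: "real^'n^'m"
  assumes "(A + E) *v y = b + e"
  shows "(norm (A *v y - b))\<^sup>2 \<le> (1 + (norm y)\<^sup>2) * (norm (E, e))\<^sup>2"
proof -
  have "append_column E e *v extend_vec y (-1) = - (A *v y - b)"
    using assms by (simp add: append_column_mult mv.add_left algebra_simps)
  then have "norm (A *v y - b) \<le> norm (append_column E e) * norm (extend_vec y (-1))"
    by (metis norm_matrix_vector_mult_le norm_minus_cancel)
  then have "(norm (A *v y - b))\<^sup>2 \<le> (norm (append_column E e))\<^sup>2 * (norm (extend_vec y (-1)))\<^sup>2"
    unfolding power_mult_distrib[symmetric] by (rule power_mono) simp
  moreover have "(norm (append_column E e))\<^sup>2 = (norm (E, e))\<^sup>2"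
    by (simp only: norm_Pair real_sqrt_pow2 sum_power2_ge_zero)
      (simp add: power2_norm_eq_inner inner_vec_def append_column_def sum_UNIV_option sum.distrib)
  ultimately show ?thesis by (simp add: norm_extend_vec algebra_simps)
qed

text \<open>Equality holds for the rank-one choice [E, e] = -q (y, -1)^T with q = (A y - b) / (1 +
  |y|^2).\<close>

lemma tls_correction_attained:
  fixes A :: "real^'n^'m"
  obtains E e where "(A + E) *v y = b + e"
    "(norm (A *v y - b))\<^sup>2 = (1 + (norm y)\<^sup>2) * (norm (E, e))\<^sup>2"
proof
  define k where "k = 1 + (norm y)\<^sup>2"
  have k: "k > 0" by (simp add: k_def add_pos_nonneg)
  define q where "q = (1 / k) *\<^sub>R (A *v y - b)"
  have "outer_product q y *v y + q = A *v y - b"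
    using k by (simp add: outer_product_mult q_def power2_norm_eq_inner[symmetric] scaleR_left_distrib[symmetric])
       (simp add: k_def add_divide_distrib[symmetric] add.commute)
  then show "(A + - outer_product q y) *v y = b + q"
    by (simp add: mv.diff_left algebra_simps)
  have "(norm (- outer_product q y, q))\<^sup>2 = k * (norm q)\<^sup>2"
    by (simp add: norm_Pair norm_outer_product k_def algebra_simps)
  also have "\<dots> = (norm (A *v y - b))\<^sup>2 / k"
    using k by (simp add: q_def power_mult_distrib power2_eq_square)
  finally show "(norm (A *v y - b))\<^sup>2 = (1 + (norm y)\<^sup>2) * (norm (- outer_product q y, q))\<^sup>2"
    using k by (simp add: k_def)
qed

lemma is_tls_solution_iff:
  assumes "tls_generic A b"
  shows "is_tls_solution A b y \<longleftrightarrow> y = tls_x A b"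
proof -
  let ?l = "tls_lambda A b"
  define c where "c = (min_singular_value A)\<^sup>2 - ?l"
  have c: "0 < c" "\<And>u. c * (norm u)\<^sup>2 \<le> u \<bullet> (tls_B A b *v u)"
    using tls_gap_pos[OF assms] tls_B_coercive by (auto simp: c_def)
  have pos: "0 < 1 + (norm u)\<^sup>2" for u :: "real^'n"
    by (simp add: add_pos_nonneg)
  \<comment> \<open>A correction admitting y costs at least \<lambda> plus an excess that vanishes
    only at y = x. This one bound yields both optimality and uniqueness of x.\<close>
  have lower: "?l + c * (norm (y - tls_x A b))\<^sup>2 / (1 + (norm y)\<^sup>2) \<le> (norm (E, e))\<^sup>2"
    if "(A + E) *v y = b + e" for E e y
  proof -
    have "?l * (1 + (norm y)\<^sup>2) + c * (norm (y - tls_x A b))\<^sup>2 \<le> (1 + (norm y)\<^sup>2) * (norm (E, e))\<^sup>2"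
      using c(2)[of "y - tls_x A b"] tls_objective[OF assms, of y] tls_correction_lower_bound[OF that]
      by linarith
    then show ?thesis using pos[of y] by (simp add: field_simps)
  qed
  obtain E e where E: "(A + E) *v tls_x A b = b + e" "(norm (E, e))\<^sup>2 = ?l"
  proof -
    obtain E e where "(A + E) *v tls_x A b = b + e"
      "(norm (A *v tls_x A b - b))\<^sup>2 = (1 + (norm (tls_x A b))\<^sup>2) * (norm (E, e))\<^sup>2"
      by (rule tls_correction_attained)
    then show ?thesis
      using that[of E e] norm_tls_residual[OF assms] pos[of "tls_x A b"] by simp
  qed
  show ?thesis
  proof
    assume "is_tls_solution A b y"
    then obtain E' e' where E': "(A + E') *v y = b + e'" "norm (E', e') \<le> norm (E, e)"
      unfolding is_tls_solution_def using E(1) by blast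
    have "?l + c * (norm (y - tls_x A b))\<^sup>2 / (1 + (norm y)\<^sup>2) \<le> ?l"
      using lower[OF E'(1)] E(2) power_mono[OF E'(2), of 2] by simp
    then have "(norm (y - tls_x A b))\<^sup>2 \<le> 0"
      using c(1) pos[of y] by (simp add: divide_le_0_iff mult_le_0_iff)
    then show "y = tls_x A b" by simp
  next
    assume y: "y = tls_x A b"
    have "norm (E, e) \<le> norm (E', e')" if "(A + E') *v x' = b + e'" for E' e' x'
    proof -
      have "?l \<le> (norm (E', e'))\<^sup>2"
        using c(1) pos[of x']
        by (intro order_trans[OF _ lower[OF that]]) simp
      then show ?thesis using E(2) by (intro power2_le_imp_le[OF _ norm_ge_zero]) simp
    qed
    then show "is_tls_solution A b y"
      unfolding is_tls_solution_def using E(1) y by blast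
  qed
qed

section \<open>Differentiability\<close>

text \<open>A product rule in which continuity of g suffices: f vanishes at x, so f p = O(|p - x|),
  and its product with g p - g x -> 0 is o(|p - x|). Thus g may be replaced by the constant g
  x.\<close>

lemma (in bounded_bilinear) has_derivative_vanishing:
  fixes f :: "'d::real_normed_vector \<Rightarrow> 'a"
  assumes f: "(f has_derivative f') (at x)" and "f x = 0" and g: "isCont g x"
  shows "((\<lambda>p. prod (f p) (g p)) has_derivative (\<lambda>h. prod (f' h) (g x))) (at x)"
proof -
  obtain K where K: "0 \<le> K" "\<And>a b. norm (prod a b) \<le> norm a * norm b * K"
    using nonneg_bounded by blast
  let ?q = "\<lambda>p. norm (f p - f x - f' (p - x)) / norm (p - x)"
  have q: "(?q \<longlongrightarrow> 0) (at x)" and lin: "bounded_linear f'"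
    using f by (auto simp: has_derivative_iff_norm)
  have "((\<lambda>p. (?q p + onorm f') * norm (g p - g x) * K) \<longlongrightarrow> (0 + onorm f') * norm (g x - g x) * K) (at x)"
    using g by (intro tendsto_intros q) (simp add: isCont_def)
  then have lim: "((\<lambda>p. (?q p + onorm f') * norm (g p - g x) * K) \<longlongrightarrow> 0) (at x)" by simp
  have "((\<lambda>p. prod (f p) (g p - g x)) has_derivative (\<lambda>h. 0)) (at x)"
    unfolding has_derivative_iff_norm
  proof (intro conjI bounded_linear_zero Lim_null_comparison[OF _ lim] always_eventually allI)
    fix p
    have "norm (f p) \<le> norm (f p - f x - f' (p - x)) + norm (f' (p - x))"
      using norm_triangle_ineq[of "f p - f x - f' (p - x)" "f' (p - x)"] assms(2) by simp
    also have "\<dots> \<le> norm (f p - f x - f' (p - x)) + onorm f' * norm (p - x)"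
      using onorm[OF lin] by simp
    finally have "norm (f p) / norm (p - x) \<le> (norm (f p - f x - f' (p - x)) + onorm f' * norm (p - x)) / norm (p - x)"
      by (rule divide_right_mono) simp
    \<comment> \<open>At p = x both quotients are 0 by division by zero, and what remains is 0 \<le>
      \<open>onorm f'\<close>.\<close>
    also have "\<dots> \<le> ?q p + onorm f'"
      using onorm_pos_le[OF lin] by (cases "p = x") (auto simp: add_divide_distrib)
    finally have *: "norm (f p) / norm (p - x) \<le> ?q p + onorm f'" .
    have "norm (prod (f p) (g p - g x)) / norm (p - x) \<le> norm (f p) * norm (g p - g x) * K / norm (p - x)"
      by (intro divide_right_mono K) simp
    also have "\<dots> = norm (f p) / norm (p - x) * (norm (g p - g x) * K)" by simp
    also have "\<dots> \<le> (?q p + onorm f') * (norm (g p - g x) * K)"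
      using * K(1) by (intro mult_right_mono) auto
    finally show "norm (norm (prod (f p) (g p - g x) - prod (f x) (g x - g x) - 0) / norm (p - x))
                    \<le> (?q p + onorm f') * norm (g p - g x) * K"
      by (simp add: zero_right mult.assoc)
  qed
  moreover have "((\<lambda>p. prod (f p) (g x)) has_derivative (\<lambda>h. prod (f' h) (g x))) (at x)"
    by (rule bounded_linear.has_derivative[OF bounded_linear_left f])
  ultimately have "((\<lambda>p. prod (f p) (g p - g x) + prod (f p) (g x)) has_derivative (\<lambda>h. 0 + prod (f' h) (g x))) (at x)"
    by (rule has_derivative_add)
  then show ?thesis by (simp add: diff_right)
qed

section \<open>Openness of genericity and continuity of \<lambda> and x\<close>

lemma isCont_min_singular_value_append_column:
  "isCont (\<lambda>p. min_singular_value (append_column (fst p) (snd p))) q"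
  by (rule isCont_o2[OF linear_continuous_at isCont_min_singular_value])
    (rule linear_conv_bounded_linear[THEN iffD1, OF linear_append_column])

lemma isCont_tls_lambda: "isCont (\<lambda>p. tls_lambda (fst p) (snd p)) q"
  unfolding tls_lambda_def
  by (intro isCont_power isCont_min_singular_value_append_column)

lemma isCont_min_singular_value_fst: "isCont (\<lambda>p. min_singular_value (fst p)) q"
  by (rule isCont_o2[OF isCont_fst[OF continuous_ident] isCont_min_singular_value])

lemma eventually_tls_generic:
  assumes "tls_generic A b"
  shows "\<forall>\<^sub>F p in at (A, b). tls_generic (fst p) (snd p)"
proof -
  have "isCont (\<lambda>p. min_singular_value (fst p) - min_singular_value (append_column (fst p) (snd p))) (A, b)"
    by (intro continuous_intros isCont_min_singular_value_fst isCont_min_singular_value_append_column)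
  then have "((\<lambda>p. min_singular_value (fst p) - min_singular_value (append_column (fst p) (snd p)))
      \<longlongrightarrow> min_singular_value A - min_singular_value (append_column A b)) (at (A, b))"
    by (simp add: isCont_def)
  from order_tendstoD(1)[OF this, of 0] assms show ?thesis
    by (simp add: tls_generic_def)
qed

text \<open>Coercivity of the perturbed B turns a small right-hand side into a small x' - x, with a
  bound whose constant depends continuously on the data.\<close>

lemma isCont_tls_x:
  fixes A :: "real^'n^'m"
  assumes "tls_generic A b"
  shows "isCont (\<lambda>p. tls_x (fst p) (snd p)) (A, b)"
proof -
  define x where "x = tls_x A b"
  \<comment> \<open>N p is the perturbed B applied to x' - x. It involves only the fixed x and the
    continuous \<lambda>, so its continuity is known before that of x'.\<close>
  define N where "N p = tls_lambda (fst p) (snd p) *\<^sub>R x - (fst p *v x - snd p) v* fst p"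
    for p :: "(real^'n^'m) \<times> (real^'m)"
  define gap where "gap p = (min_singular_value (fst p))\<^sup>2 - tls_lambda (fst p) (snd p)"
    for p :: "(real^'n^'m) \<times> (real^'m)"
  have "isCont N (A, b)" "isCont gap (A, b)"
    unfolding N_def gap_def
    by (intro continuous_intros isCont_tls_lambda isCont_min_singular_value_fst
        mv.isCont vm.isCont isCont_fst isCont_snd)+
  moreover have gap: "0 < gap (A, b)" using tls_gap_pos[OF assms] by (simp add: gap_def)
  ultimately have "((\<lambda>p. norm (N p) / gap p) \<longlongrightarrow> norm (N (A, b)) / gap (A, b)) (at (A, b))"
    by (intro tendsto_intros) (auto simp: isCont_def)
  moreover have "N (A, b) = 0" using tls_residual(1)[OF assms] by (simp add: N_def x_def)
  ultimately have lim: "((\<lambda>p. norm (N p) / gap p) \<longlongrightarrow> 0) (at (A, b))" by simp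
  have "\<forall>\<^sub>F p in at (A, b). norm (tls_x (fst p) (snd p) - x) \<le> norm (N p) / gap p"
    using eventually_tls_generic[OF assms]
  proof eventually_elim
    case (elim p)
    define u where "u = tls_x (fst p) (snd p) - x"
    have pos: "0 < gap p" using tls_gap_pos[OF elim] by (simp add: gap_def)
    have "tls_B (fst p) (snd p) *v u = N p"
      by (simp add: u_def mv.diff_right tls_B_tls_x[OF elim])
        (simp add: N_def tls_B_mult vm.diff_left)
    then have "gap p * (norm u)\<^sup>2 \<le> u \<bullet> N p"
      using tls_B_coercive[of "fst p" "snd p" u] by (simp add: gap_def)
    also have "\<dots> \<le> norm u * norm (N p)" by (rule norm_cauchy_schwarz)
    finally have "norm u * (gap p * norm u) \<le> norm u * norm (N p)"
      by (simp add: power2_eq_square algebra_simps)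
    then have "gap p * norm u \<le> norm (N p)"
      by (cases "u = 0") auto
    then show ?case using pos by (simp add: u_def field_simps)
  qed
  then have "((\<lambda>p. tls_x (fst p) (snd p) - x) \<longlongrightarrow> 0) (at (A, b))"
    using lim by (rule Lim_null_comparison)
  then show ?thesis
    by (simp add: isCont_def x_def LIM_zero_iff)
qed

text \<open>
  Since \<open>(x', -1)\<close> and \<open>(x, -1)\<close> are eigenvectors of \<open>M'\<^sup>T M'\<close> and \<open>M\<^sup>T M\<close> respectively, testing the
  difference of these two matrices with both of them isolates the change of the eigenvalue exactly,
  without any remainder.
\<close>

lemma tls_lambda_difference:
  fixes A A' :: "real^'n^'m"
  assumes "tls_generic A b" "tls_generic A' b'"
  defines "x \<equiv> tls_x A b" and "x' \<equiv> tls_x A' b'"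
  shows "(tls_lambda A' b' - tls_lambda A b) * (1 + x \<bullet> x') =
    ((A' - A) *v x' - (b' - b)) \<bullet> (A' *v x - b') + ((A' - A) *v x - (b' - b)) \<bullet> (A *v x' - b)"
proof -
  have "(A' *v x' - b') \<bullet> (A' *v x - b') = ((A' *v x' - b') v* A') \<bullet> x - (A' *v x' - b') \<bullet> b'"
    by (simp only: dot_lmul_matrix inner_diff_right)
  then have 1: "(A' *v x' - b') \<bullet> (A' *v x - b') = tls_lambda A' b' * (1 + x \<bullet> x')"
    using tls_residual[OF assms(2)] by (simp add: x'_def algebra_simps inner_commute)
  have "(A *v x - b) \<bullet> (A *v x' - b) = ((A *v x - b) v* A) \<bullet> x' - (A *v x - b) \<bullet> b"
    by (simp only: dot_lmul_matrix inner_diff_right)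
  then have 2: "(A *v x - b) \<bullet> (A *v x' - b) = tls_lambda A b * (1 + x \<bullet> x')"
    using tls_residual[OF assms(1)] by (simp add: x_def algebra_simps inner_commute)
  have 3: "(A' - A) *v y - (b' - b) = (A' *v y - b') - (A *v y - b)" for y
    by (simp add: mv.diff_left)
  show ?thesis
    unfolding 3 left_diff_distrib 1[symmetric] 2[symmetric]
    by (simp add: inner_diff_left inner_diff_right inner_commute)
qed

text \<open>Subtract the normal equations of both pairs and split A'^T r' - A^T (A x' - b), where r'
  = A' x' - b', into a part with A' - A on the left and a part with the change of the residual at
  x'.\<close>

lemma tls_x_difference:
  fixes A A' :: "real^'n^'m"
  assumes "tls_generic A b" "tls_generic A' b'"
  defines "x \<equiv> tls_x A b" and "x' \<equiv> tls_x A' b'"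
  shows "tls_B A b *v (x' - x) = (tls_lambda A' b' - tls_lambda A b) *\<^sub>R x'
    - (A' *v x' - b') v* (A' - A) - ((A' - A) *v x' - (b' - b)) v* A"
proof -
  have "tls_B A b *v (x' - x) = (A *v x' - b) v* A - tls_lambda A b *\<^sub>R x'"
    using tls_B_tls_x[OF assms(1)] by (simp add: mv.diff_right x_def tls_B_mult vm.diff_left)
  also have "\<dots> = (tls_lambda A' b' - tls_lambda A b) *\<^sub>R x'
      - (A' *v x' - b') v* A' + (A *v x' - b) v* A"
    using tls_residual(1)[OF assms(2)] by (simp add: x'_def scaleR_left_diff_distrib)
  finally show ?thesis
    by (simp add: vm.diff_right vm.diff_left mv.diff_left)
qed

text \<open>This is B applied to the derivative of x; the coefficient of x is the derivative of
  \<lambda>.\<close>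

definition tls_rhs_derivative ::
    "real^'n^'m \<Rightarrow> real^'m \<Rightarrow> (real^'n^'m) \<times> (real^'m) \<Rightarrow> real^'n" where
  "tls_rhs_derivative A b h =
     (let x = tls_x A b; r = A *v x - b; s = fst h *v x - snd h
      in (2 * (s \<bullet> r) / (1 + (norm x)\<^sup>2)) *\<^sub>R x - r v* fst h - s v* A)"

text \<open>Solve \<open>tls_lambda_difference\<close> for \<lambda>' - \<lambda>. Each summand
  pairs a factor vanishing at (A, b) with a merely continuous one, so continuity of x' is
  enough.\<close>

lemma has_derivative_tls_lambda:
  fixes A :: "real^'n^'m"
  assumes "tls_generic A b"
  shows "((\<lambda>p. tls_lambda (fst p) (snd p)) has_derivative
    (\<lambda>h. 2 * ((fst h *v tls_x A b - snd h) \<bullet> (A *v tls_x A b - b)) / (1 + (norm (tls_x A b))\<^sup>2)))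
    (at (A, b))"
proof -
  define x where "x = tls_x A b"
  define X where "X p = tls_x (fst p) (snd p)" for p :: "(real^'n^'m) \<times> (real^'m)"
  have X0: "X (A, b) = x" by (simp add: X_def x_def)
  have X: "isCont X (A, b)" using isCont_tls_x[OF assms] by (simp add: X_def[abs_def])
  \<comment> \<open>Needed twice: with Y = X and with Y constantly x.\<close>
  have d: "((\<lambda>p. (fst p - A) *v Y p - (snd p - b)) has_derivative (\<lambda>h. fst h *v x - snd h)) (at (A, b))"
    if "isCont Y (A, b)" "Y (A, b) = x" for Y
  proof -
    have "((\<lambda>p. (fst p - A) *v Y p) has_derivative (\<lambda>h. fst h *v Y (A, b))) (at (A, b))"
      by (rule mv.has_derivative_vanishing) (auto intro!: derivative_eq_intros that(1))
    moreover have "((\<lambda>p. snd p - b) has_derivative snd) (at (A, b))"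
      by (auto intro!: derivative_eq_intros)
    ultimately show ?thesis unfolding that(2) by (rule has_derivative_diff)
  qed
  let ?F = "\<lambda>p. ((fst p - A) *v X p - (snd p - b)) \<bullet> (fst p *v x - snd p)
                 + ((fst p - A) *v x - (snd p - b)) \<bullet> (A *v X p - b)"
  have c1: "isCont (\<lambda>p. fst p *v x - snd p) (A, b)" and c2: "isCont (\<lambda>p. A *v X p - b) (A, b)"
    by (intro continuous_intros mv.isCont X)+
  have "(?F has_derivative (\<lambda>h. (fst h *v x - snd h) \<bullet> (fst (A, b) *v x - snd (A, b))
       + (fst h *v x - snd h) \<bullet> (A *v X (A, b) - b))) (at (A, b))"
    by (intro has_derivative_add bounded_bilinear.has_derivative_vanishing[OF bounded_bilinear_inner]
        d c1 c2 X X0) (simp_all)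
  then have F: "(?F has_derivative (\<lambda>h. 2 * ((fst h *v x - snd h) \<bullet> (A *v x - b)))) (at (A, b))"
    by (simp add: X0)
  have c3: "isCont (\<lambda>p. 1 + x \<bullet> X p) (A, b)" by (intro continuous_intros X)
  have pos: "0 < 1 + x \<bullet> X (A, b)" by (simp add: X0 add_pos_nonneg)
  \<comment> \<open>The numerator vanishes at (A, b), so the denominator also enters only through
    its value there.\<close>
  have "((\<lambda>p. ?F p * inverse (1 + x \<bullet> X p)) has_derivative
      (\<lambda>h. 2 * ((fst h *v x - snd h) \<bullet> (A *v x - b)) * inverse (1 + x \<bullet> X (A, b)))) (at (A, b))"
    using pos by (intro bounded_bilinear.has_derivative_vanishing[OF bounded_bilinear_mult] F
        continuous_at_within_inverse c3) (auto simp: X0)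
  from has_derivative_add[OF has_derivative_const[of "tls_lambda A b"] this]
  have "((\<lambda>p. tls_lambda A b + ?F p * inverse (1 + x \<bullet> X p)) has_derivative
      (\<lambda>h. 2 * ((fst h *v x - snd h) \<bullet> (A *v x - b)) / (1 + (norm x)\<^sup>2))) (at (A, b))"
    by (simp add: X0 power2_norm_eq_inner divide_inverse)
  then show ?thesis
    unfolding x_def[symmetric]
  proof (rule has_derivative_transform_eventually)
    have "\<forall>\<^sub>F p in at (A, b). 0 < 1 + x \<bullet> X p"
      using c3 pos by (auto simp: isCont_def intro: order_tendstoD)
    with eventually_tls_generic[OF assms]
    show "\<forall>\<^sub>F p in at (A, b). tls_lambda A b + ?F p * inverse (1 + x \<bullet> X p) = tls_lambda (fst p) (snd p)"
    proof eventually_elim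
      case (elim p)
      have "?F p = (tls_lambda (fst p) (snd p) - tls_lambda A b) * (1 + x \<bullet> X p)"
        using tls_lambda_difference[OF assms elim(1)] by (simp add: x_def X_def)
      moreover have "1 + x \<bullet> X p \<noteq> 0" using elim(2) by simp
      ultimately show ?case by (simp only: mult.assoc right_inverse) simp
    qed
  qed auto
qed

text \<open>Apply the fixed inverse of B to \<open>tls_x_difference\<close>: each summand on its
  right is a product with a vanishing factor, or a fixed linear image of such products and a linear
  term.\<close>

lemma has_derivative_tls_x:
  fixes A :: "real^'n^'m"
  assumes "tls_generic A b"
  shows "((\<lambda>p. tls_x (fst p) (snd p)) has_derivative
    (\<lambda>h. matrix_inv (tls_B A b) *v tls_rhs_derivative A b h)) (at (A, b))"
proof -
  define x where "x = tls_x A b"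
  define X where "X p = tls_x (fst p) (snd p)" for p :: "(real^'n^'m) \<times> (real^'m)"
  define l where "l p = tls_lambda (fst p) (snd p)" for p :: "(real^'n^'m) \<times> (real^'m)"
  let ?r = "A *v x - b" and ?dl = "\<lambda>h. 2 * ((fst h *v x - snd h) \<bullet> (A *v x - b)) / (1 + (norm x)\<^sup>2)"
  have X0: "X (A, b) = x" by (simp add: X_def x_def)
  have X: "isCont X (A, b)" using isCont_tls_x[OF assms] by (simp add: X_def[abs_def])
  have fst_d: "((\<lambda>p. fst p - A) has_derivative fst) (at (A, b))"
    and snd_d: "((\<lambda>p. snd p - b) has_derivative snd) (at (A, b))"
    by (auto intro!: derivative_eq_intros)
  have 1: "((\<lambda>p. (l p - l (A, b)) *\<^sub>R X p) has_derivative (\<lambda>h. ?dl h *\<^sub>R X (A, b))) (at (A, b))"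
  proof (rule bounded_bilinear.has_derivative_vanishing[OF bounded_bilinear_scaleR])
    show "((\<lambda>p. l p - l (A, b)) has_derivative ?dl) (at (A, b))"
      using has_derivative_diff[OF has_derivative_tls_lambda[OF assms] has_derivative_const]
      by (simp add: l_def x_def)
  qed (auto simp: X)
  \<comment> \<open>Here the vanishing factor is the second one, hence the flipped product.\<close>
  have 2: "((\<lambda>p. (fst p *v X p - snd p) v* (fst p - A)) has_derivative
      (\<lambda>h. (fst (A, b) *v X (A, b) - snd (A, b)) v* fst h)) (at (A, b))"
    by (rule bounded_bilinear.has_derivative_vanishing[OF vm.flip fst_d])
      (auto intro!: continuous_intros mv.isCont X)
  have 3: "((\<lambda>p. (fst p - A) *v X p - (snd p - b)) has_derivative (\<lambda>h. fst h *v X (A, b) - snd h)) (at (A, b))"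
    by (intro has_derivative_diff mv.has_derivative_vanishing fst_d snd_d X) simp
  have "((\<lambda>p. (l p - l (A, b)) *\<^sub>R X p - (fst p *v X p - snd p) v* (fst p - A)
          - ((fst p - A) *v X p - (snd p - b)) v* A)
      has_derivative tls_rhs_derivative A b) (at (A, b))"
    using has_derivative_diff[OF has_derivative_diff[OF 1 2]
        bounded_linear.has_derivative[OF vm.bounded_linear_left 3]]
    by (simp add: X0 tls_rhs_derivative_def[abs_def] Let_def x_def)
  from has_derivative_add[OF has_derivative_const[of x]
      bounded_linear.has_derivative[OF matrix_vector_mul_bounded_linear[of "matrix_inv (tls_B A b)"] this]]
  show ?thesis
  proof (rule has_derivative_transform_eventually[where x = "(A, b)", THEN has_derivative_eq_rhs])
    show "\<forall>\<^sub>F p in at (A, b). x + matrix_inv (tls_B A b) *v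
        ((l p - l (A, b)) *\<^sub>R X p - (fst p *v X p - snd p) v* (fst p - A)
          - ((fst p - A) *v X p - (snd p - b)) v* A) = tls_x (fst p) (snd p)"
      using eventually_tls_generic[OF assms]
    proof eventually_elim
      case (elim p)
      have "x + matrix_inv (tls_B A b) *v (tls_B A b *v (X p - x)) = X p"
        by (simp add: matrix_inv_mult_cancel(1)[OF invertible_tls_B[OF assms]])
      then show ?case
        using tls_x_difference[OF assms elim] by (simp add: X_def x_def l_def)
    qed
  qed (auto simp: X0 X_def x_def l_def)
qed

section \<open>Condition number\<close>

text \<open>Inner products with all w determine J h, and they are linear in h. Linearity of the
  explicit maps below thus comes with their adjoint identity.\<close>

lemma linear_of_adjoint:
  assumes "\<And>h w. J h \<bullet> w = h \<bullet> J' w"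
  shows "linear J"
  by (rule linearI; rule vector_eq_rdot[THEN iffD1])
    (simp_all only: assms inner_add_left inner_scaleR_left simp_thms)

text \<open>Testing J h and J' w against themselves gives |J| = |J'|. Then |J' w|^2 = J (J' w) . w
  bounds |J|^2 by |J J'|, and submultiplicativity gives the converse.\<close>

lemma onorm_comp_adjoint:
  fixes J :: "'a::euclidean_space \<Rightarrow> 'b::euclidean_space"
  assumes adj: "\<And>h w. J h \<bullet> w = h \<bullet> J' w"
  shows "onorm (\<lambda>w. J (J' w)) = (onorm J)\<^sup>2"
proof -
  have lin: "linear J" "linear J'"
    by (rule linear_of_adjoint[OF adj], rule linear_of_adjoint[of J' J])
      (simp only: inner_commute[of "J' _"] adj[symmetric], rule inner_commute)
  have bl: "bounded_linear J" "bounded_linear J'" "bounded_linear (\<lambda>w. J (J' w))"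
    using lin linear_compose[OF lin(2,1)] by (simp_all only: linear_conv_bounded_linear comp_def)
  note le = onorm[OF bl(1)] onorm[OF bl(2)] onorm[OF bl(3)]
  note pos = onorm_pos_le[OF bl(1)] onorm_pos_le[OF bl(2)] onorm_pos_le[OF bl(3)]
  have "norm (J h) \<le> onorm J' * norm h" for h
  proof -
    have "norm (J h) * norm (J h) = h \<bullet> J' (J h)"
      by (simp add: adj[symmetric] power2_norm_eq_inner[symmetric] power2_eq_square)
    also have "\<dots> \<le> norm h * norm (J' (J h))" by (rule norm_cauchy_schwarz)
    also have "\<dots> \<le> norm h * (onorm J' * norm (J h))" by (intro mult_left_mono le) simp
    finally have "norm (J h) * norm (J h) \<le> norm (J h) * (onorm J' * norm h)"
      by (simp add: algebra_simps)
    then show ?thesis using pos(2) by (cases "norm (J h) = 0") auto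
  qed
  then have J: "onorm J \<le> onorm J'" by (rule onorm_bound[OF pos(2)])
  have "norm (J' w) \<le> onorm J * norm w" for w
  proof -
    have "norm (J' w) * norm (J' w) = J (J' w) \<bullet> w"
      by (simp add: adj power2_norm_eq_inner[symmetric] power2_eq_square)
    also have "\<dots> \<le> norm (J (J' w)) * norm w" by (rule norm_cauchy_schwarz)
    also have "\<dots> \<le> (onorm J * norm (J' w)) * norm w" by (intro mult_right_mono le) simp
    finally have "norm (J' w) * norm (J' w) \<le> norm (J' w) * (onorm J * norm w)"
      by (simp add: algebra_simps)
    then show ?thesis using pos(1) by (cases "norm (J' w) = 0") auto
  qed
  then have J': "onorm J' \<le> onorm J" by (rule onorm_bound[OF pos(1)])
  have "norm (J' w) \<le> sqrt (onorm (\<lambda>w. J (J' w))) * norm w" for w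
  proof -
    have "(norm (J' w))\<^sup>2 = J (J' w) \<bullet> w" by (simp add: adj power2_norm_eq_inner)
    also have "\<dots> \<le> norm (J (J' w)) * norm w" by (rule norm_cauchy_schwarz)
    also have "\<dots> \<le> onorm (\<lambda>w. J (J' w)) * norm w * norm w" by (intro mult_right_mono le) simp
    also have "\<dots> = (sqrt (onorm (\<lambda>w. J (J' w))) * norm w)\<^sup>2"
      by (simp only: power_mult_distrib real_sqrt_pow2[OF pos(3)] power2_eq_square[of "norm w"] mult.assoc)
    finally show ?thesis
      by (rule power2_le_imp_le) (simp only: mult_nonneg_nonneg real_sqrt_ge_zero pos(3) norm_ge_zero)
  qed
  then have "onorm J' \<le> sqrt (onorm (\<lambda>w. J (J' w)))" by (rule onorm_bound[OF real_sqrt_ge_zero[OF pos(3)]])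
  then have "(onorm J)\<^sup>2 \<le> (sqrt (onorm (\<lambda>w. J (J' w))))\<^sup>2"
    by (rule power_mono[OF order_trans[OF J] pos(1)])
  moreover have "onorm (\<lambda>w. J (J' w)) \<le> onorm J * onorm J'"
    using onorm_compose[OF bl(1,2)] by (simp add: comp_def)
  then have "onorm (\<lambda>w. J (J' w)) \<le> (onorm J)\<^sup>2"
    unfolding power2_eq_square using J' pos(1) by (meson mult_left_mono order_trans)
  ultimately show ?thesis by (simp only: real_sqrt_pow2[OF pos(3)] order_antisym)
qed

section \<open>Symmetric matrices and the adjoint of the derivative\<close>

lemma transpose_eq_self_iff:
  fixes M :: "real^'n^'n"
  shows "transpose M = M \<longleftrightarrow> (\<forall>u v. (M *v u) \<bullet> v = u \<bullet> (M *v v))"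
proof
  assume "transpose M = M"
  then have "M *v u = u v* M" for u by (metis transpose_matrix_vector)
  then show "\<forall>u v. (M *v u) \<bullet> v = u \<bullet> (M *v v)" by (simp add: dot_lmul_matrix)
next
  assume sym: "\<forall>u v. (M *v u) \<bullet> v = u \<bullet> (M *v v)"
  have "u v* M = M *v u" for u
    by (rule vector_eq_rdot[THEN iffD1]) (simp add: dot_lmul_matrix sym)
  then show "transpose M = M" by (simp add: matrix_eq)
qed

lemma inner_matrix_inv_symmetric:
  fixes M :: "real^'n^'n"
  assumes "transpose M = M" "invertible M"
  shows "(matrix_inv M *v u) \<bullet> v = u \<bullet> (matrix_inv M *v v)"
proof -
  have "(M *v (matrix_inv M *v u)) \<bullet> (matrix_inv M *v v) = (matrix_inv M *v u) \<bullet> (M *v (matrix_inv M *v v))"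
    using assms(1) unfolding transpose_eq_self_iff by blast
  then show ?thesis by (simp add: matrix_inv_mult_cancel(2)[OF assms(2)])
qed

text \<open>Found by writing D(E, e) . z as -r . (E z) - s . q, where D is
  \<open>tls_rhs_derivative\<close>, s = E x - e and q collects all factors paired with s; the
  coefficients of E and e then give the two components.\<close>

definition tls_rhs_adjoint ::
    "real^'n^'m \<Rightarrow> real^'m \<Rightarrow> real^'n \<Rightarrow> (real^'n^'m) \<times> (real^'m)" where
  "tls_rhs_adjoint A b z =
     (let x = tls_x A b; r = A *v x - b; q = A *v z - (2 * (x \<bullet> z) / (1 + (norm x)\<^sup>2)) *\<^sub>R r
      in (- outer_product r z - outer_product q x, q))"

lemma inner_tls_rhs_derivative:
  "tls_rhs_derivative A b h \<bullet> z = h \<bullet> tls_rhs_adjoint A b z"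
proof -
  define x where "x = tls_x A b"
  define r where "r = A *v x - b"
  define s where "s = fst h *v x - snd h"
  define k where "k = 2 / (1 + (norm x)\<^sup>2)"
  have "tls_rhs_derivative A b h \<bullet> z = k * (s \<bullet> r) * (x \<bullet> z) - r \<bullet> (fst h *v z) - s \<bullet> (A *v z)"
    unfolding tls_rhs_derivative_def Let_def x_def[symmetric] r_def[symmetric] s_def[symmetric]
    by (simp add: inner_diff_left dot_lmul_matrix k_def)
  also have "\<dots> = - (fst h *v z) \<bullet> r - s \<bullet> (A *v z - (k * (x \<bullet> z)) *\<^sub>R r)"
    by (simp add: inner_diff_right inner_commute algebra_simps)
  also have "\<dots> = h \<bullet> tls_rhs_adjoint A b z"
    unfolding tls_rhs_adjoint_def Let_def x_def[symmetric] r_def[symmetric] inner_prod_def s_def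
    by (simp add: inner_diff_left inner_diff_right inner_outer_product k_def algebra_simps
        diff_divide_distrib)
  finally show ?thesis .
qed

text \<open>Perturbations in the range of the adjoint leave \<lambda> unchanged to first order, so
  only the two terms -E^T r and -A^T s have to be evaluated.\<close>

lemma tls_rhs_derivative_adjoint:
  assumes "tls_generic A b"
  defines "x \<equiv> tls_x A b" and "l \<equiv> tls_lambda A b"
  shows "tls_rhs_derivative A b (tls_rhs_adjoint A b z) =
    (1 + (norm x)\<^sup>2) *\<^sub>R ((A *v z) v* A + l *\<^sub>R (z - (2 / (1 + (norm x)\<^sup>2) * (x \<bullet> z)) *\<^sub>R x))"
proof -
  define N where "N = 1 + (norm x)\<^sup>2"
  define t where "t = x \<bullet> z"
  define r where "r = A *v x - b"
  define q where "q = A *v z - (2 * t / N) *\<^sub>R r"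
  define E where "E = - outer_product r z - outer_product q x"
  have N: "0 < N" by (simp add: N_def add_pos_nonneg)
  have adj: "tls_rhs_adjoint A b z = (E, q)"
    unfolding tls_rhs_adjoint_def Let_def x_def[symmetric] r_def[symmetric] N_def[symmetric]
      t_def[symmetric] q_def[symmetric] E_def ..
  have rA: "r v* A = l *\<^sub>R x" and rr: "r \<bullet> r = l * N"
    using tls_residual(1)[OF assms(1)] norm_tls_residual[OF assms(1)]
    by (simp_all add: r_def x_def l_def N_def power2_norm_eq_inner)
  have "(A *v z) \<bullet> r = l * t"
    by (simp add: inner_commute[of _ r] dot_lmul_matrix[symmetric] rA t_def)
  then have qr: "q \<bullet> r = - l * t"
    using N by (simp add: q_def inner_diff_left rr)
  have "E *v x = - (t *\<^sub>R r) - (x \<bullet> x) *\<^sub>R q"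
    by (simp add: E_def mv.diff_left mv.minus_left outer_product_mult t_def inner_commute[of z x])
  then have s: "E *v x - q = - (t *\<^sub>R r) - N *\<^sub>R q"
    by (simp add: N_def power2_norm_eq_inner scaleR_add_left)
  \<comment> \<open>The contributions t |r|^2 = t l N and N (q . r) = -N l t cancel; this removes
    the \<lambda> term of the derivative.\<close>
  have sr: "(E *v x - q) \<bullet> r = 0"
    unfolding s by (simp add: inner_diff_left qr rr algebra_simps)
  have rE: "r v* E = - (l * N) *\<^sub>R z + (l * t) *\<^sub>R x"
    by (simp add: E_def vm.diff_right vm.minus_right mult_outer_product rr qr)
  have sA: "(E *v x - q) v* A = (l * t) *\<^sub>R x - N *\<^sub>R ((A *v z) v* A)"
  proof -
    have "(E *v x - q) v* A = (- (l * t)) *\<^sub>R x - N *\<^sub>R (q v* A)"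
      unfolding s by (simp add: vm.diff_left vm.minus_left vm.scaleR_left rA mult.commute)
    also have "N *\<^sub>R (q v* A) = N *\<^sub>R ((A *v z) v* A) - (2 * (l * t)) *\<^sub>R x"
      using N by (simp add: q_def vm.diff_left vm.scaleR_left rA scaleR_diff_right mult_ac)
    also have "(- (l * t)) *\<^sub>R x - (N *\<^sub>R ((A *v z) v* A) - (2 * (l * t)) *\<^sub>R x)
        = (- (l * t) + 2 * (l * t)) *\<^sub>R x - N *\<^sub>R ((A *v z) v* A)"
      by (simp only: scaleR_add_left diff_diff_eq2)
    finally show ?thesis by simp
  qed
  have coeff: "N * (l * (2 / N * t)) = l * t + l * t" using N by simp
  have "tls_rhs_derivative A b (E, q) = - (r v* E) - (E *v x - q) v* A"
    unfolding tls_rhs_derivative_def Let_def x_def[symmetric] r_def[symmetric] fst_conv snd_conv sr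
    by simp
  also have "\<dots> = (l * N) *\<^sub>R z - (l * t + l * t) *\<^sub>R x + N *\<^sub>R ((A *v z) v* A)"
    unfolding rE sA scaleR_add_left by simp
  also have "\<dots> = N *\<^sub>R ((A *v z) v* A + l *\<^sub>R (z - (2 / N * t) *\<^sub>R x))"
    unfolding scaleR_add_right scaleR_diff_right scaleR_scaleR coeff by (simp add: mult.commute)
  finally show ?thesis by (simp add: adj N_def t_def)
qed

theorem theorem1:
  fixes A :: "real^'n^'m" and b :: "real^'m" and L :: "real^'k^'n"
    and lam :: real and B :: "real^'n^'n" and x :: "real^'n" and C :: "real^'k^'k"
  assumes "CARD('m) > CARD('n)"
    and "CARD('k) \<le> CARD('n)"
    and "tls_generic A b"
    and "lam = (min_singular_value (append_column A b))\<^sup>2"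
    and "B = transpose A ** A - lam *\<^sub>R mat 1"
    and "x = matrix_inv B *v (transpose A *v b)"
    and "C = (1 + (norm x)\<^sup>2) *\<^sub>R
           (transpose L ** matrix_inv B **
            (transpose A ** A + lam *\<^sub>R (mat 1 - (2 / (1 + (norm x)\<^sup>2)) *\<^sub>R outer x x)) **
            matrix_inv B ** L)"
  shows "(\<forall>y. is_tls_solution A b y \<longleftrightarrow> y = x) \<and>
         tls_map L differentiable (at (A, b)) \<and>
         transpose C = C \<and>
         tls_cond L A b = sqrt (spectral_norm C)"
proof -
  have lam: "lam = tls_lambda A b" using assms(4) by (simp add: tls_lambda_def)
  have B: "B = tls_B A b" using assms(5) lam by (simp add: tls_B_def)
  have x: "x = tls_x A b" using assms(6) B by (simp add: tls_x_def)
  have inv: "invertible B" using invertible_tls_B[OF assms(3)] B by simp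
  define J where "J h = transpose L *v (matrix_inv B *v tls_rhs_derivative A b h)" for h
  define J' where "J' w = tls_rhs_adjoint A b (matrix_inv B *v (L *v w))" for w
  have "(tls_map L has_derivative J) (at (A, b))"
    using bounded_linear.has_derivative[OF matrix_vector_mul_bounded_linear[of "transpose L"]
        has_derivative_tls_x[OF assms(3)]]
    by (simp add: tls_map_def J_def[abs_def] B case_prod_beta')
  then have diff: "tls_map L differentiable (at (A, b))"
    and J: "frechet_derivative (tls_map L) (at (A, b)) = J"
    by (rule differentiableI, rule frechet_derivative_at[symmetric])
  \<comment> \<open>B is symmetric, so its inverse is its own adjoint and reappears unchanged in
    J'.\<close>
  have adj: "J h \<bullet> w = h \<bullet> J' w" for h w
    using inner_matrix_inv_symmetric[OF tls_B_symmetric invertible_tls_B[OF assms(3)]]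
    by (simp add: J_def J'_def dot_lmul_matrix B inner_tls_rhs_derivative[symmetric])
  have outer: "outer x x = outer_product x x" by (simp add: outer_def outer_product_def)
  have C: "C *v w = J (J' w)" for w
    unfolding J_def J'_def tls_rhs_derivative_adjoint[OF assms(3)]
    by (simp add: assms(7) outer x[symmetric] lam[symmetric] matrix_vector_mul_assoc[symmetric]
        mv.add_left mv.diff_left mv.scaleR_left outer_product_mult
        mv.scaleR_right vm.scaleR_left)
  \<comment> \<open>Symmetry is read off from the factorisation C = J J' rather than from the matrix
    formula.\<close>
  have "(C *v u) \<bullet> v = u \<bullet> (C *v v)" for u v
    using adj[of "J' u" v] adj[of "J' v" u] by (simp add: C inner_commute)
  then have "transpose C = C" by (simp add: transpose_eq_self_iff)
  moreover have "spectral_norm C = (onorm J)\<^sup>2"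
    using onorm_comp_adjoint[OF adj] by (simp add: spectral_norm_def C[abs_def])
  moreover have "0 \<le> onorm J"
    using linear_of_adjoint[OF adj] by (intro onorm_pos_le) (simp add: linear_conv_bounded_linear)
  ultimately show ?thesis
    using is_tls_solution_iff[OF assms(3)] x diff by (simp add: tls_cond_def J)
qed

end
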